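(* There exist $2\times 2$ matrices $A_1,A_2,\ldots,A_8$ in Jordan form over $\mathbb{C}$ such that $(A_1,A_2,\ldots,A_8)$ is hypercyclic on $\mathbb{C}^2$.
   Context: A $2\times 2$ matrix is said to be in Jordan form over a field $\mathbb{F}$ ($\mathbb{R}$ or $\mathbb{C}$) if it is of the form $\begin{pmatrix}a&1\\0&a\end{pmatrix}$ with $a\in\mathbb{F}$ (any two such matrices commute). A tuple $(T_1,\ldots,T_m)$ of pairwise commuting continuous linear operators on a space $X$ is hypercyclic if there is $x\in X$ such that $\{T_1^{k_1}\cdots T_m^{k_m}x : k_1,\ldots,k_m\geq 0 \text{ integers}\}$ is dense in $X$. *)

theory Defs
  imports "HOL-Analysis.Analysis"
begin

definition jordan_form2 :: "'k::field ^ 2 ^ 2 \<Rightarrow> bool" where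
  "jordan_form2 A \<longleftrightarrow> (\<exists>a. A = vector [vector [a, 1], vector [0, a]])"

(* The set of all vectors T_1^{k_1} ... T_m^{k_m} x, where Ts = [T_1, ..., T_m]
   and ks = [k_1, ..., k_m]; a product of operators is their composition. *)
definition tuple_orbit :: "('a \<Rightarrow> 'a) list \<Rightarrow> 'a \<Rightarrow> 'a set" where
  "tuple_orbit Ts x =
     {foldr (\<circ>) (map2 (\<lambda>T k. T ^^ k) Ts ks) id x | ks :: nat list. length ks = length Ts}"

(* The scalar multiplication is a parameter, so that linearity is over the intended
   field and not only over the reals. *)
definition hypercyclic_tuple ::
    "('k::field \<Rightarrow> 'a \<Rightarrow> 'a) \<Rightarrow> ('a::{ab_group_add, topological_space} \<Rightarrow> 'a) list \<Rightarrow> bool" where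
  "hypercyclic_tuple smul Ts \<longleftrightarrow>
     (\<forall>T \<in> set Ts. Vector_Spaces.linear smul smul T \<and> continuous_on UNIV T) \<and>
     (\<forall>S \<in> set Ts. \<forall>T \<in> set Ts. S \<circ> T = T \<circ> S) \<and>
     (\<exists>x. closure (tuple_orbit Ts x) = UNIV)"

end

theory Submission
  imports Defs "HOL-Complex_Analysis.Conformal_Mappings"
begin

text \<open>
  In the coordinates (S, L) \<mapsto> (exp L * S, exp L), whose image is dense, the Jordan matrix with
  eigenvalue exp l acts as the translation by (exp (-l), l), and (0, 2 pi i) is a period. So
  it suffices to find l_1, ..., l_4 such that the translations together with the period generate a
  dense subsemigroup of the 4-dimensional real space; the other four matrices are not used.
  Fix l_1, l_2, l_3 so that the corresponding vectors and the period form a real basis v_0, ..., v_3,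
  and write the fourth vector as -(c_0 v_0 + ... + c_3 v_3). If c_1, c_2, c_3 are positive and
  1, c_0, ..., c_3 are linearly independent over the rationals, then Kronecker's theorem makes the
  multiples of the fourth vector dense modulo the lattice, and using only large multiples keeps the
  coefficients of v_1, v_2, v_3 nonnegative. Such an l_4 exists on the curve l = -(t^2 + i t):
  near t = 0 the c_j are positive, and every rational relation is a nontrivial analytic
  equation in t, so that only countably many t are excluded.
\<close>

section \<open>Kronecker approximation with large multipliers\<close>

lemma Kronecker_large_multiple:
  fixes \<theta> \<alpha> :: "nat \<Rightarrow> real"
  assumes indep: "\<And>m :: nat \<Rightarrow> int. (\<Sum>i<n. of_int (m i) * \<theta> i) \<in> \<int> \<Longrightarrow> \<forall>i<n. m i = 0"
    and "\<epsilon> > 0"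
  obtains k :: nat and h :: "nat \<Rightarrow> int"
  where "k \<ge> N" "\<And>i. i < n \<Longrightarrow> \<bar>of_nat k * \<theta> i - of_int (h i) - \<alpha> i\<bar> < \<epsilon>"
proof -
  interpret Modules.module "\<lambda>r. (*) (real_of_int r)"
    by (simp add: Modules.module.intro distrib_left mult.commute)
  \<comment> \<open>Appending the value 1 at index \<open>n\<close> turns the hypothesis into plain
    independence over the integers, the form in which Kronecker's theorem is applied.\<close>
  define \<theta>' where "\<theta>' = \<theta>(n := 1)"
  have zero: "m i = 0" if "(\<Sum>i\<le>n. of_int (m i) * \<theta>' i) = 0" "i \<le> n" for m :: "nat \<Rightarrow> int" and i
  proof -
    have "(\<Sum>i<n. of_int (m i) * \<theta>' i) = (\<Sum>i<n. of_int (m i) * \<theta> i)"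
      by (rule sum.cong) (auto simp: \<theta>'_def)
    then have *: "(\<Sum>i<n. of_int (m i) * \<theta> i) + of_int (m n) = 0"
      using that(1) by (simp add: lessThan_Suc_atMost [symmetric] \<theta>'_def)
    then have "(\<Sum>i<n. of_int (m i) * \<theta> i) = of_int (- m n)"
      by simp
    then have **: "\<forall>i<n. m i = 0"
      by (intro indep) (metis Ints_of_int)
    with * have "m n = 0" by simp
    with ** that(2) show ?thesis by (cases "i = n") auto
  qed
  \<comment> \<open>\<open>independent\<close> speaks of a set of values, so repeated values must be
    excluded first.\<close>
  have inj: "inj_on \<theta>' {..n}"
  proof (rule inj_onI, rule ccontr)
    fix i j assume ij: "i \<in> {..n}" "j \<in> {..n}" "\<theta>' i = \<theta>' j" "i \<noteq> j"
    let ?m = "\<lambda>l. (if l = i then 1 else 0) - (if l = j then 1 else 0) :: int"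
    have "(\<Sum>l\<le>n. of_int (?m l) * \<theta>' l)
          = (\<Sum>l\<le>n. (if l = i then \<theta>' l else 0)) - (\<Sum>l\<le>n. (if l = j then \<theta>' l else 0))"
      by (simp only: sum_subtractf [symmetric]) (rule sum.cong, auto)
    also have "\<dots> = 0" using ij by simp
    finally have "?m i = 0" by (rule zero) (use ij in auto)
    with ij show False by simp
  qed
  have "independent (\<theta>' ` {..n})"
  proof
    assume "dependent (\<theta>' ` {..n})"
    then obtain f i where i: "i \<le> n" "f (\<theta>' i) \<noteq> 0"
      and "(\<Sum>x\<in>\<theta>' ` {..n}. of_int (f x) * x) = 0"
      by (auto simp: dependent_finite)
    then have "(\<Sum>i\<le>n. of_int (f (\<theta>' i)) * \<theta>' i) = 0"
      by (simp add: sum.reindex [OF inj] o_def)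
    from zero [OF this i(1)] i(2) show False by simp
  qed
  then obtain k m where km: "\<And>i. i < n \<Longrightarrow> \<bar>of_int k * \<theta>' i - of_int (m i) - \<alpha> i\<bar> < \<epsilon> / 2"
    using Kronecker_thm_2 [of \<theta>' n "\<epsilon> / 2" \<alpha>] inj \<open>\<epsilon> > 0\<close> by (auto simp: \<theta>'_def)
  \<comment> \<open>Kronecker's \<open>k\<close> may be negative. Adding \<open>q * M\<close> with
    \<open>q \<ge> 1\<close> lifts it to at least \<open>N\<close>; Dirichlet's theorem picks
    \<open>q\<close> with all \<open>q * M * \<theta> i\<close> nearly integral, which costs the
    other half of \<open>\<epsilon>\<close>.\<close>
  define M where "M = N + nat \<bar>k\<bar>"
  obtain R :: nat where R: "R > 0" "1 / R < \<epsilon> / 2"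
    using \<open>\<epsilon> > 0\<close> by (metis gr_zeroI half_gt_zero inverse_eq_divide real_arch_inverse)
  obtain q p where qp: "0 < q" "\<And>i. i < n \<Longrightarrow> \<bar>of_int q * (real M * \<theta> i) - of_int (p i)\<bar> < 1 / R"
    using Dirichlet_approx_simult [OF R(1), of n "\<lambda>i. real M * \<theta> i"] by metis
  have "int M \<le> q * int M" using qp(1) by (simp add: mult_le_cancel_right1)
  then have le: "int N \<le> k + q * int M" by (simp add: M_def)
  show thesis
  proof
    show "N \<le> nat (k + q * int M)" using le by linarith
    fix i assume i: "i < n"
    have "of_nat (nat (k + q * int M)) = (of_int k + of_int q * real M :: real)"
      using le by simp
    then have "of_nat (nat (k + q * int M)) * \<theta> i - of_int (m i + p i) - \<alpha> i
      = (of_int k * \<theta>' i - of_int (m i) - \<alpha> i) + (of_int q * (real M * \<theta> i) - of_int (p i))"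
      using i by (simp add: \<theta>'_def algebra_simps)
    then show "\<bar>of_nat (nat (k + q * int M)) * \<theta> i - of_int (m i + p i) - \<alpha> i\<bar> < \<epsilon>"
      using km [OF i] qp(2) [OF i] R(2) by linarith
  qed
qed

text \<open>Each \<open>h i\<close> is close to \<open>k * \<theta> i + \<tau> i\<close>, which is
  nonnegative for large \<open>k\<close> when \<open>\<theta> i > 0\<close>.\<close>

lemma Kronecker_semigroup:
  fixes v :: "nat \<Rightarrow> 'a::real_normed_vector" and \<theta> \<tau> :: "nat \<Rightarrow> real"
  assumes indep: "\<And>m :: nat \<Rightarrow> int. (\<Sum>i<n. of_int (m i) * \<theta> i) \<in> \<int> \<Longrightarrow> \<forall>i<n. m i = 0"
    and "\<epsilon> > 0"
  obtains k :: nat and h :: "nat \<Rightarrow> int"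
  where "\<And>i. i < n \<Longrightarrow> \<theta> i > 0 \<Longrightarrow> h i \<ge> 0"
    "norm ((\<Sum>i<n. of_int (h i) *\<^sub>R v i) - of_nat k *\<^sub>R (\<Sum>i<n. \<theta> i *\<^sub>R v i) - (\<Sum>i<n. \<tau> i *\<^sub>R v i)) < \<epsilon>"
proof -
  define C where "C = 1 + (\<Sum>i<n. norm (v i))"
  have C: "C > 0" unfolding C_def by (intro add_pos_nonneg sum_nonneg) auto
  \<comment> \<open>The bound \<open>\<epsilon> / C\<close> controls the norm; the bound 1 gives
    \<open>h i > - 1\<close>, hence \<open>h i \<ge> 0\<close> for an integer.\<close>
  define \<delta> where "\<delta> = min 1 (\<epsilon> / C)"
  have \<delta>: "\<delta> > 0" "\<delta> \<le> 1" using C \<open>\<epsilon> > 0\<close> by (simp_all add: \<delta>_def)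
  have "\<delta> \<le> \<epsilon> / C" by (simp add: \<delta>_def)
  with C have \<delta>C: "\<delta> * C \<le> \<epsilon>" by (simp add: pos_le_divide_eq)
  \<comment> \<open>From \<open>B\<close> on,
    \<open>k * \<theta> i \<ge> \<bar>\<tau> i\<bar> + 1\<close> for every positive
    \<open>\<theta> i\<close>. The absolute values keep all summands nonnegative, so each is at most
    \<open>B\<close>.\<close>
  define B where "B = (\<Sum>i<n. (\<bar>\<tau> i\<bar> + 1) / \<bar>\<theta> i\<bar>)"
  obtain N :: nat where N: "B \<le> real N" using real_arch_simple by blast
  obtain k h where k: "k \<ge> N"
    and h: "\<And>i. i < n \<Longrightarrow> \<bar>of_nat k * \<theta> i - of_int (h i) - (- \<tau> i)\<bar> < \<delta>"
    using Kronecker_large_multiple [OF indep \<delta>(1), where N = N and \<alpha> = "\<lambda>i. - \<tau> i"] by blast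
  show thesis
  proof
    fix i assume i: "i < n" "\<theta> i > 0"
    have "(\<bar>\<tau> i\<bar> + 1) / \<bar>\<theta> i\<bar> \<le> B"
      unfolding B_def using i by (intro member_le_sum) auto
    also have "\<dots> \<le> real k" using N k by simp
    finally have "\<bar>\<tau> i\<bar> + 1 \<le> real k * \<theta> i" using i by (simp add: field_simps)
    with h [OF i(1)] \<delta>(2) have "of_int (h i) > (- 1 :: real)" by linarith
    then show "h i \<ge> 0" by linarith
  next
    have "norm ((\<Sum>i<n. of_int (h i) *\<^sub>R v i) - of_nat k *\<^sub>R (\<Sum>i<n. \<theta> i *\<^sub>R v i) - (\<Sum>i<n. \<tau> i *\<^sub>R v i))
       = norm (\<Sum>i<n. (of_int (h i) - of_nat k * \<theta> i - \<tau> i) *\<^sub>R v i)"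
      by (simp add: scaleR_sum_right sum_subtractf scaleR_diff_left)
    also have "\<dots> \<le> (\<Sum>i<n. \<delta> * norm (v i))"
    proof (intro order_trans [OF norm_sum] sum_mono)
      fix i assume "i \<in> {..<n}"
      then show "norm ((of_int (h i) - of_nat k * \<theta> i - \<tau> i) *\<^sub>R v i) \<le> \<delta> * norm (v i)"
        using h [of i] by (auto intro!: mult_right_mono)
    qed
    also have "\<dots> < \<delta> * C"
      using \<delta>(1) by (simp add: C_def sum_distrib_left [symmetric])
    finally show "norm ((\<Sum>i<n. of_int (h i) *\<^sub>R v i) - of_nat k *\<^sub>R (\<Sum>i<n. \<theta> i *\<^sub>R v i) - (\<Sum>i<n. \<tau> i *\<^sub>R v i)) < \<epsilon>"
      using \<delta>C by simp
  qed
qed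

section \<open>Jordan matrices as translations in an exponential chart\<close>

definition jordan2 :: "'k::field \<Rightarrow> 'k ^ 2 ^ 2" where
  "jordan2 a = vector [vector [a, 1], vector [0, a]]"

lemma jordan2_mult_vector:
  "jordan2 a *v vector [x, y] = vector [a * x + y, a * y]"
  by (simp add: jordan2_def vec_eq_iff forall_2 matrix_vector_mult_def sum_2)

lemma jordan2_commute: "jordan2 a ** jordan2 b = jordan2 b ** jordan2 a"
  by (simp add: jordan2_def vec_eq_iff forall_2 matrix_matrix_mult_def sum_2 algebra_simps)

lemma continuous_on_jordan2: "continuous_on UNIV ((*v) (jordan2 a :: complex ^ 2 ^ 2))"
  unfolding matrix_vector_mult_def by (intro continuous_intros)

definition log_lift :: "complex \<Rightarrow> complex \<times> complex" where
  "log_lift l = (exp (- l), l)"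

definition exp_chart :: "complex \<times> complex \<Rightarrow> complex ^ 2" where
  "exp_chart p = vector [exp (snd p) * fst p, exp (snd p)]"

text \<open>This is
  \<open>exp l * (exp L * S) + exp L = exp (L + l) * (S + exp (- l))\<close>.\<close>

lemma jordan2_exp_chart: "jordan2 (exp l) *v exp_chart p = exp_chart (p + log_lift l)"
  by (simp add: exp_chart_def log_lift_def jordan2_mult_vector vec_eq_iff forall_2
      exp_add exp_minus field_simps)

lemma jordan2_funpow_exp_chart:
  "((*v) (jordan2 (exp l)) ^^ k) (exp_chart p) = exp_chart (p + of_nat k *\<^sub>R log_lift l)"
  by (induction k) (simp_all add: jordan2_exp_chart algebra_simps)

lemma jordan2_foldr_exp_chart:
  assumes "length ks = length ls"
  shows "foldr (\<circ>) (map2 (\<lambda>T k. T ^^ k) (map (\<lambda>l. (*v) (jordan2 (exp l))) ls) ks) id (exp_chart p)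
    = exp_chart (p + (\<Sum>(l, k)\<leftarrow>zip ls ks. of_nat k *\<^sub>R log_lift l))"
  using assms
  by (induction ks ls rule: list_induct2) (simp_all add: jordan2_funpow_exp_chart algebra_simps)

lemma exp_chart_periodic: "exp_chart (of_int n *\<^sub>R (0, 2 * pi * \<i>) + p) = exp_chart p"
proof -
  have "exp (of_int n * (2 * of_real pi * \<i>)) = (1 :: complex)"
    using exp_integer_2pi [OF Ints_of_int, of n] by (simp add: mult_ac)
  then show ?thesis
    by (simp add: exp_chart_def exp_add scaleR_conv_of_real)
qed

lemma continuous_on_exp_chart: "continuous_on S exp_chart"
proof -
  have eq: "exp_chart = (\<lambda>p. \<chi> i. if i = 1 then exp (snd p) * fst p else exp (snd p))"
    by (auto simp: fun_eq_iff vec_eq_iff forall_2 exp_chart_def)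
  have "continuous_on S (\<lambda>p. if i = 1 then exp (snd p) * fst p else exp (snd p))" for i :: 2
    by (cases "i = 1") (auto intro!: continuous_intros)
  then show ?thesis
    unfolding eq by (rule continuous_on_vec_lambda)
qed

text \<open>Only vectors with second coordinate 0 are missed, and a small shift of that coordinate
  reaches the range.\<close>

lemma closure_range_exp_chart: "closure (range exp_chart) = UNIV"
proof -
  have range: "y \<in> range exp_chart" if "y $ 2 \<noteq> 0" for y
  proof
    show "y = exp_chart (y $ 1 / y $ 2, Ln (y $ 2))"
      using that by (simp add: exp_chart_def vec_eq_iff forall_2)
  qed simp
  have "\<exists>y\<in>range exp_chart. dist y x < e" if "e > 0" for x e
  proof (cases "x $ 2 = 0")
    case True
    have "dist (x + axis 2 (of_real (e / 2))) x < e"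
      using \<open>e > 0\<close> by (simp add: dist_norm norm_vec_def L2_set_def axis_def sum_2 norm_divide)
    moreover have "x + axis 2 (of_real (e / 2)) \<in> range exp_chart"
      using \<open>e > 0\<close> True by (intro range) (simp add: axis_def)
    ultimately show ?thesis by blast
  next
    case False
    then show ?thesis using range [of x] \<open>e > 0\<close> by (metis dist_self)
  qed
  then show ?thesis by (auto simp: closure_approachable)
qed

section \<open>A curve with rationally independent coordinates\<close>

lemma analytic_relation:
  fixes \<alpha> \<beta> \<gamma> \<delta> \<epsilon> :: real
  assumes "uncountable T"
    and T: "\<And>t :: real. t \<in> T \<Longrightarrow> exp (t\<^sup>2) * (\<alpha> * cos t + \<beta> * sin t) + \<gamma> * t\<^sup>2 + \<delta> * t + \<epsilon> = 0"
  shows "\<alpha> = 0" "\<beta> = 0" "\<gamma> = 0" "\<delta> = 0" "\<epsilon> = 0"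
proof -
  \<comment> \<open>The relation extends to an entire function; with uncountably many zeros it
    vanishes identically, so the relation holds for all real \<open>t\<close>.\<close>
  define F where "F z = exp (z\<^sup>2) * (of_real \<alpha> * cos z + of_real \<beta> * sin z)
      + of_real \<gamma> * z\<^sup>2 + of_real \<delta> * z + of_real \<epsilon>" for z :: complex
  have F_real: "F (of_real t) = of_real (exp (t\<^sup>2) * (\<alpha> * cos t + \<beta> * sin t) + \<gamma> * t\<^sup>2 + \<delta> * t + \<epsilon>)"
    for t :: real
    by (simp add: F_def exp_of_real [symmetric] cos_of_real [symmetric] sin_of_real [symmetric])
  have "uncountable {z \<in> UNIV. F z = 0}"
  proof
    assume "countable {z \<in> UNIV. F z = 0}"
    moreover have "of_real ` T \<subseteq> {z \<in> UNIV. F z = 0}"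
      using T by (auto simp: F_real)
    ultimately have "countable (complex_of_real ` T)"
      by (rule countable_subset [rotated])
    then show False
      using \<open>uncountable T\<close> by (simp add: countable_image_inj_eq inj_on_def)
  qed
  moreover have "F holomorphic_on UNIV"
    unfolding F_def by (intro holomorphic_intros)
  ultimately have "F z = 0" for z
    using holomorphic_countable_equal [of F UNIV "\<lambda>_. 0"] by auto
  then have f: "exp (t\<^sup>2) * (\<alpha> * cos t + \<beta> * sin t) + \<gamma> * t\<^sup>2 + \<delta> * t + \<epsilon> = 0" for t :: real
    by (metis F_real of_real_eq_0_iff)
  \<comment> \<open>Split by parity. The zeros of sine and cosine at multiples of
    \<open>pi / 2\<close> then isolate the coefficients one after another; \<open>pi / 2\<close> and
    \<open>3 * (pi / 2)\<close> give two equations for \<open>\<gamma>\<close> and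
    \<open>\<epsilon>\<close>.\<close>
  have odd: "exp (t\<^sup>2) * (\<beta> * sin t) + \<delta> * t = 0"
    and even: "exp (t\<^sup>2) * (\<alpha> * cos t) + \<gamma> * t\<^sup>2 + \<epsilon> = 0" for t :: real
    using f [of t] f [of "- t"] by (simp_all add: algebra_simps)
  show "\<delta> = 0" using odd [of pi] by simp
  then show "\<beta> = 0" using odd [of "pi / 2"] by simp
  have "cos (3 * (pi / 2)) = 0" using cos_3over2_pi by (simp add: mult.commute)
  then have "\<gamma> * (pi / 2)\<^sup>2 + \<epsilon> = 0" "9 * (\<gamma> * (pi / 2)\<^sup>2) + \<epsilon> = 0"
    using even [of "pi / 2"] even [of "3 * (pi / 2)"] by (simp_all add: power_mult_distrib power_divide)
  then have "\<epsilon> = 0" "\<gamma> * (pi / 2)\<^sup>2 = 0" by linarith+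
  then show "\<epsilon> = 0" "\<gamma> = 0" by simp_all
  then show "\<alpha> = 0" using even [of 0] by simp
qed

text \<open>
  The inverse eigenvalues of the last three vectors are 2i, -2i and -1/2. They are chosen so that
  v_1 + v_2 + 2 v_3 is (-1, 0) modulo the period, i.e. minus the value at t = 0 of the curve below.
\<close>

definition basis4 :: "nat \<Rightarrow> complex \<times> complex" where
  "basis4 i = [(0, 2 * pi * \<i>), log_lift (- Complex (ln 2) (pi / 2)),
     log_lift (- Complex (ln 2) (- pi / 2)), log_lift (Complex (ln 2) pi)] ! i"

text \<open>Solves \<open>Re S = - c_3 / 2\<close>, \<open>Im S = 2 * (c_1 - c_2)\<close>,
  \<open>Re L = ln 2 * (c_3 - c_1 - c_2)\<close> and the equation for \<open>Im L\<close>, where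
  \<open>c_i\<close> is the coefficient of \<open>basis4 i\<close>.\<close>

definition coord4 :: "complex \<times> complex \<Rightarrow> nat \<Rightarrow> real" where
  "coord4 p i = (case p of (S, L) \<Rightarrow>
     [Im L / (2 * pi) + Im S / 8 + Re S, - Re S - Re L / (2 * ln 2) + Im S / 4,
      - Re S - Re L / (2 * ln 2) - Im S / 4, - 2 * Re S] ! i)"

lemma sum_lessThan_4: "(\<Sum>i<(4::nat). f i) = f 0 + f 1 + f 2 + f 3"
  by (simp add: eval_nat_numeral)

lemma sum_coord4: "(\<Sum>i<4. coord4 p i *\<^sub>R basis4 i) = p"
proof -
  have "exp (Complex (ln 2) (pi / 2)) = 2 * \<i>" "exp (Complex (ln 2) (- pi / 2)) = - 2 * \<i>"
    "exp (- Complex (ln 2) pi) = - 1 / 2"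
    by (simp_all add: complex_eq_iff Re_exp Im_exp exp_minus)
  then show ?thesis
    by (cases p) (auto simp: sum_lessThan_4 basis4_def coord4_def log_lift_def complex_eq_iff field_simps)
qed

text \<open>Along this curve both components of \<open>log_lift\<close> have real parts even in
  \<open>t\<close> and imaginary parts odd, so that relations can be split by parity.\<close>

definition curve4 :: "real \<Rightarrow> complex" where
  "curve4 t = - Complex (t\<^sup>2) t"

lemma coord4_curve4:
  "coord4 (- log_lift (curve4 t)) 0 = t / (2 * pi) - exp (t\<^sup>2) * sin t / 8 - exp (t\<^sup>2) * cos t"
  "coord4 (- log_lift (curve4 t)) 1 = exp (t\<^sup>2) * cos t - t\<^sup>2 / (2 * ln 2) - exp (t\<^sup>2) * sin t / 4"
  "coord4 (- log_lift (curve4 t)) 2 = exp (t\<^sup>2) * cos t - t\<^sup>2 / (2 * ln 2) + exp (t\<^sup>2) * sin t / 4"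
  "coord4 (- log_lift (curve4 t)) 3 = 2 * exp (t\<^sup>2) * cos t"
  by (simp_all add: coord4_def log_lift_def curve4_def Re_exp Im_exp)

lemma coord4_curve4_pos:
  obtains d where "d > 0" "\<And>t. 0 < t \<Longrightarrow> t < d \<Longrightarrow> \<forall>i\<in>{1,2,3}. coord4 (- log_lift (curve4 t)) i > 0"
proof -
  have "((\<lambda>t. coord4 (- log_lift (curve4 t)) 1) \<longlongrightarrow> 1) (at_right 0)"
    "((\<lambda>t. coord4 (- log_lift (curve4 t)) 2) \<longlongrightarrow> 1) (at_right 0)"
    "((\<lambda>t. coord4 (- log_lift (curve4 t)) 3) \<longlongrightarrow> 2) (at_right 0)"
    unfolding coord4_curve4 by (auto intro!: tendsto_eq_intros)
  then have "\<forall>\<^sub>F t in at_right 0. coord4 (- log_lift (curve4 t)) 1 > 0"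
    "\<forall>\<^sub>F t in at_right 0. coord4 (- log_lift (curve4 t)) 2 > 0"
    "\<forall>\<^sub>F t in at_right 0. coord4 (- log_lift (curve4 t)) 3 > 0"
    by (simp_all add: order_tendstoD(1))
  then have "\<forall>\<^sub>F t in at_right 0. \<forall>i\<in>{1,2,3}. coord4 (- log_lift (curve4 t)) i > 0"
    by (simp add: eventually_conj_iff)
  then show thesis
    using that by (auto simp: eventually_at_right_field)
qed

lemma coord4_curve4_independent:
  assumes "uncountable T"
  obtains t where "t \<in> T"
    "\<And>m :: nat \<Rightarrow> int. (\<Sum>i<4. of_int (m i) * coord4 (- log_lift (curve4 t)) i) \<in> \<int> \<Longrightarrow> \<forall>i<4. m i = 0"
proof -
  \<comment> \<open>\<open>Z p\<close> holds the parameters satisfying one nontrivial integer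
    relation \<open>p\<close>. There are countably many \<open>p\<close>, so countability of each
    \<open>Z p\<close> suffices.\<close>
  define Z where "Z = (\<lambda>(m0::int, m1::int, m2::int, m3::int, n::int).
    {t \<in> T. (m0, m1, m2, m3) \<noteq> (0, 0, 0, 0) \<and>
      of_int m0 * coord4 (- log_lift (curve4 t)) 0 + of_int m1 * coord4 (- log_lift (curve4 t)) 1
      + of_int m2 * coord4 (- log_lift (curve4 t)) 2 + of_int m3 * coord4 (- log_lift (curve4 t)) 3
      = of_int n})"
  have "countable (Z p)" for p
  proof (rule ccontr)
    assume unc: "uncountable (Z p)"
    obtain m0 m1 m2 m3 n where p: "p = (m0, m1, m2, m3, n)" by (metis prod.exhaust)
    let ?\<alpha> = "- real_of_int m0 + m1 + m2 + 2 * real_of_int m3"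
    let ?\<beta> = "- real_of_int m0 / 8 - m1 / 4 + m2 / 4"
    let ?\<gamma> = "- (real_of_int m1 + m2) * inverse (2 * ln 2)"
    \<comment> \<open>Here \<open>E\<close>, \<open>c\<close>, \<open>s\<close> stand for
      \<open>exp (t^2)\<close>, \<open>cos t\<close>, \<open>sin t\<close>, and \<open>u\<close>,
      \<open>v\<close> for the inverses of \<open>2 * ln 2\<close> and \<open>2 * pi\<close>; the
      regrouping is then a polynomial identity.\<close>
    have poly: "E * ((- x0 + x1 + x2 + 2 * x3) * c + (- x0 / 8 - x1 / 4 + x2 / 4) * s)
        + (- (x1 + x2) * u) * t\<^sup>2 + (x0 * v) * t + - x
      = x0 * (t * v - E * s / 8 - E * c) + x1 * (E * c - t\<^sup>2 * u - E * s / 4)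
        + x2 * (E * c - t\<^sup>2 * u + E * s / 4) + x3 * (2 * E * c) - x"
      for E c s t u v x0 x1 x2 x3 x :: real
      by (simp add: algebra_simps)
    have *: "exp (t\<^sup>2) * (?\<alpha> * cos t + ?\<beta> * sin t) + ?\<gamma> * t\<^sup>2
        + (m0 * inverse (2 * pi)) * t + - of_int n = 0" if "t \<in> Z p" for t
      unfolding poly using that
      by (simp only: Z_def p mem_Collect_eq case_prod_conv coord4_curve4
          divide_inverse [of _ "2 * pi"] divide_inverse [of _ "2 * ln 2"] diff_self)
    \<comment> \<open>The system is triangular: \<open>m0 = 0\<close>, then
      \<open>m1 + m2 = 0\<close> and \<open>m1 = m2\<close>, then \<open>m3 = 0\<close>.\<close>
    have "m0 * inverse (2 * pi) = 0" "?\<gamma> = 0" "?\<beta> = 0" "?\<alpha> = 0"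
      using analytic_relation [OF unc *] by blast+
    then have "m0 = 0" "m1 = 0" "m2 = 0" "m3 = 0" by (simp_all add: field_simps)
    then have "Z p = {}" by (simp add: Z_def p)
    with unc show False by simp
  qed
  then have "countable (\<Union>p. Z p)" by blast
  then obtain t where t: "t \<in> T" "t \<notin> (\<Union>p. Z p)"
    using assms countable_subset [of T "\<Union>p. Z p"] by blast
  show thesis
  proof
    show "t \<in> T" by fact
    fix m :: "nat \<Rightarrow> int"
    assume "(\<Sum>i<4. of_int (m i) * coord4 (- log_lift (curve4 t)) i) \<in> \<int>"
    then obtain n where "(\<Sum>i<4. of_int (m i) * coord4 (- log_lift (curve4 t)) i) = of_int n"
      by (rule Ints_cases)
    moreover have "t \<notin> Z (m 0, m 1, m 2, m 3, n)" using t by blast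
    ultimately have "m 0 = 0 \<and> m 1 = 0 \<and> m 2 = 0 \<and> m 3 = 0"
      using t(1) by (auto simp: Z_def sum_lessThan_4)
    then show "\<forall>i<4. m i = 0" by (auto simp: eval_nat_numeral less_Suc_eq)
  qed
qed

section \<open>Density of the translation semigroup and of the orbit\<close>

lemma dense_log_lift_semigroup:
  obtains l where "closure {(\<Sum>i<4. of_int (h i) *\<^sub>R basis4 i) + of_nat k *\<^sub>R log_lift l | h k.
     \<forall>i\<in>{1,2,3}. h i \<ge> 0} = UNIV"
proof -
  obtain d where d: "d > 0"
    "\<And>t. 0 < t \<Longrightarrow> t < d \<Longrightarrow> \<forall>i\<in>{1,2,3}. coord4 (- log_lift (curve4 t)) i > 0"
    using coord4_curve4_pos by blast
  obtain t where t: "t \<in> {0<..<d}"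
    and indep: "\<And>m :: nat \<Rightarrow> int.
      (\<Sum>i<4. of_int (m i) * coord4 (- log_lift (curve4 t)) i) \<in> \<int> \<Longrightarrow> \<forall>i<4. m i = 0"
    using coord4_curve4_independent [of "{0<..<d}"] d(1) uncountable_open_interval by blast
  define l where "l = curve4 t"
  \<comment> \<open>\<open>h 0\<close> may be negative because \<open>basis4 0\<close> is a period;
    the other coefficients become exponents of matrices.\<close>
  let ?D = "{(\<Sum>i<4. of_int (h i) *\<^sub>R basis4 i) + of_nat k *\<^sub>R log_lift l | h k. \<forall>i\<in>{1,2,3}. h i \<ge> 0}"
  have "\<exists>y\<in>?D. dist y x < e" if "e > 0" for x e
  proof -
    obtain k :: nat and h :: "nat \<Rightarrow> int"
      where h: "\<And>i. i < 4 \<Longrightarrow> coord4 (- log_lift l) i > 0 \<Longrightarrow> h i \<ge> 0"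
        and "norm ((\<Sum>i<4. of_int (h i) *\<^sub>R basis4 i)
          - of_nat k *\<^sub>R (\<Sum>i<4. coord4 (- log_lift l) i *\<^sub>R basis4 i)
          - (\<Sum>i<4. coord4 x i *\<^sub>R basis4 i)) < e"
      \<comment> \<open>With \<open>\<theta>\<close> the coordinates of \<open>- log_lift l\<close>,
        subtracting \<open>k\<close> times their combination adds \<open>k\<close> times
        \<open>log_lift l\<close>.\<close>
      using Kronecker_semigroup [OF indep \<open>e > 0\<close>, where v = basis4 and \<tau> = "coord4 x"]
      unfolding l_def by blast
    then have "dist ((\<Sum>i<4. of_int (h i) *\<^sub>R basis4 i) + of_nat k *\<^sub>R log_lift l) x < e"
      unfolding sum_coord4 by (simp add: dist_norm)
    moreover have "\<forall>i\<in>{1,2,3}. h i \<ge> 0"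
      using h d(2) [of t] t by (auto simp: l_def)
    ultimately show ?thesis by blast
  qed
  then have "closure ?D = UNIV" by (auto simp: closure_approachable)
  then show thesis by (rule that)
qed

theorem theorem1p3:
  shows "\<exists>As :: (complex ^ 2 ^ 2) list.
           length As = 8 \<and> (\<forall>A \<in> set As. jordan_form2 A) \<and>
           hypercyclic_tuple (*s) (map (*v) As)"
proof -
  obtain l where l: "closure {(\<Sum>i<4. of_int (h i) *\<^sub>R basis4 i) + of_nat k *\<^sub>R log_lift l | h k.
     \<forall>i\<in>{1,2,3}. h i \<ge> 0} = UNIV" (is "closure ?D = UNIV")
    by (rule dense_log_lift_semigroup)
  \<comment> \<open>The first three entries lift to \<open>basis4 1\<close>,
    \<open>basis4 2\<close>, \<open>basis4 3\<close>; each 0 gives eigenvalue 1 and receives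
    exponent 0 below.\<close>
  define ls where "ls = [- Complex (ln 2) (pi / 2), - Complex (ln 2) (- pi / 2), Complex (ln 2) pi,
    l, 0, 0, 0, 0]"
  define As where "As = map (\<lambda>l. jordan2 (exp l)) ls"
  \<comment> \<open>The starting vector is \<open>(0, 1)\<close>, the chart image of the origin, so
    orbit points are chart images of the semigroup itself.\<close>
  let ?orbit = "tuple_orbit (map (*v) As) (exp_chart 0)"
  have As: "map (*v) As = map (\<lambda>l. (*v) (jordan2 (exp l))) ls"
    by (simp add: As_def)
  have "exp_chart p \<in> ?orbit" if "p \<in> ?D" for p
  proof -
    from that obtain h k where p: "p = (\<Sum>i<4. of_int (h i) *\<^sub>R basis4 i) + of_nat k *\<^sub>R log_lift l"
      and h: "\<forall>i\<in>{1,2,3}. h i \<ge> (0 :: int)"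
      by blast
    define ks where "ks = [nat (h 1), nat (h 2), nat (h 3), k, 0, 0, 0, 0]"
    have len: "length ks = length ls" by (simp add: ks_def ls_def)
    have "p = of_int (h 0) *\<^sub>R (0, 2 * pi * \<i>) + (0 + (\<Sum>(l, k)\<leftarrow>zip ls ks. of_nat k *\<^sub>R log_lift l))"
      unfolding p sum_lessThan_4 using h by (simp add: basis4_def ls_def ks_def algebra_simps)
    then have "exp_chart p = exp_chart (0 + (\<Sum>(l, k)\<leftarrow>zip ls ks. of_nat k *\<^sub>R log_lift l))"
      by (simp only: exp_chart_periodic)
    also have "\<dots> = foldr (\<circ>) (map2 (\<lambda>T k. T ^^ k) (map (*v) As) ks) id (exp_chart 0)"
      unfolding As by (rule jordan2_foldr_exp_chart [OF len, symmetric])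
    finally show ?thesis
      using len unfolding tuple_orbit_def As_def by (auto simp del: foldr_map)
  qed
  \<comment> \<open>By continuity the closed set \<open>closure ?orbit\<close> contains the image of
    \<open>closure ?D\<close>, that is, the whole range of the chart, which is dense.\<close>
  then have "exp_chart ` ?D \<subseteq> closure ?orbit"
    using closure_subset by blast
  then have "exp_chart ` closure ?D \<subseteq> closure ?orbit"
    by (intro image_closure_subset continuous_on_exp_chart) auto
  then have "closure (range exp_chart) \<subseteq> closure ?orbit"
    unfolding l by (simp add: closure_minimal)
  then have "closure ?orbit = UNIV"
    by (simp add: closure_range_exp_chart top.extremum_unique)
  moreover have "jordan2 a *v (jordan2 b *v x) = jordan2 b *v (jordan2 a *v x)"
    for a b :: complex and x
    by (simp add: matrix_vector_mul_assoc jordan2_commute)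
  ultimately have "hypercyclic_tuple (*s) (map (*v) As)"
    unfolding hypercyclic_tuple_def
    by (auto simp: As_def fun_eq_iff continuous_on_jordan2)
  moreover have "length As = 8" by (simp add: As_def ls_def)
  moreover have "\<forall>A \<in> set As. jordan_form2 A"
    by (auto simp: As_def jordan_form2_def jordan2_def)
  ultimately show ?thesis by blast
qed

end
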